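(* Let $\psi$ be a waiting-time density on $\mathbb{N}=\{1,2,\dots\}$, let $N(t)$ be the generator process with waiting-time density $\psi$, let $\Phi^{(0)}(t)=\mathbb{P}(N(t)=0)$, and let $\Lambda(a,b,t)=\mathbb{E}[a^{N(t)}b^{t-N(t)}]=\sum_{n=0}^t\mathbb{P}(N(t)=n)\,a^nb^{t-n}$. Then $\Lambda(a,b,0)=1$ and, for all $t\in\mathbb{N}$, $$\Lambda(a,b,t)=b^t\,\Phi^{(0)}(t)+\sum_{r=1}^t a\,b^{r-1}\,\psi(r)\,\Lambda(a,b,t-r).$$ Correspondingly, the ADTRW transition matrix $\mathbf{P}(t)=\sum_{n=0}^t\mathbb{P}(N(t)=n)(\mathbf{W}^+)^n(\mathbf{W}^-)^{t-n}$ satisfies $\mathbf{P}(0)=\mathbf{1}$ and $$\mathbf{P}(t)=(\mathbf{W}^-)^t\,\Phi^{(0)}(t)+\sum_{r=1}^t\psi(r)\,\mathbf{W}^+(\mathbf{W}^-)^{r-1}\,\mathbf{P}(t-r),\qquad t\in\mathbb{N}.$$ In particular, for the simple ADTRW, $$P_{i,j}(t)=\Phi^{(0)}(t)\,\delta_{i,j+t}+\sum_{r=1}^t\psi(r)\,P_{i,j+r-2}(t-r),\qquad P_{i,j}(0)=\delta_{i,j},\qquad i,j\in\mathbb{Z},\ t\in\mathbb{N}.$$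
   Context: A waiting-time density is a function $\psi:\mathbb{N}\to[0,1]$ with $\sum_{t\ge1}\psi(t)=1$. The generator process with waiting-time density $\psi$ is the discrete-time renewal counting process $N(t)=\max\{n\ge0:\Delta t_1+\dots+\Delta t_n\le t\}$, $t\in\mathbb{N}_0$, with $\Delta t_1,\Delta t_2,\dots$ i.i.d., $\mathbb{P}(\Delta t_j=t)=\psi(t)$. $\mathbf{W}^+$ and $\mathbf{W}^-$ are stochastic matrices indexed by $\mathbb{Z}\times\mathbb{Z}$ that are Toeplitz ($W^\pm_{p,q}=W^\pm_{p+s,q+s}$ for all $s\in\mathbb{Z}$; hence they commute), with $W^+_{p,q}=0$ unless $q>p$ and $W^-_{p,q}=0$ unless $q<p$ (single-jump transition matrices for positive and negative jumps). The ADTRW (asymmetric discrete-time random walk) is the walk on $\mathbb{Z}$ that makes at each integer time a jump governed by $\mathbf{W}^+$ if an arrival of $N$ occurs and by $\mathbf{W}^-$ otherwise; its transition matrix is $\mathbf{P}(t)$ as displayed in the claim. The simple ADTRW is the case of unit jumps: $W^+_{p,q}=\delta_{p,q-1}$, $W^-_{p,q}=\delta_{p,q+1}$, $P_{i,j}(t)=\mathbb{P}(Y_t=j-i)$ with $Y_t=2N(t)-t$. $\mathbf{1}$ is the identity matrix, $\delta$ the Kronecker symbol, $x^0=1$. *)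

theory Defs
  imports "HOL-Probability.Probability"
begin

text \<open>Natural numbers start at 1 in the domain of a waiting-time density; the value of
  a density at 0 is never used and is left unconstrained.\<close>

definition waiting_time_density :: "(nat \<Rightarrow> real) \<Rightarrow> bool" where
  "waiting_time_density \<psi> \<longleftrightarrow> (\<forall>t\<ge>1. 0 \<le> \<psi> t \<and> \<psi> t \<le> 1) \<and> (\<psi> has_sum 1) {1..}"

text \<open>The waiting times \<open>\<Delta> 1, \<Delta> 2, \<dots>\<close> take values in \<open>{1..}\<close> everywhere (this is part of
  measurability into \<open>count_space {1..}\<close>), so the maximum below is over a finite
  nonempty set and \<open>arrivals \<Delta> t \<omega> \<le> t\<close>; the later subtractions \<open>t - arrivals \<Delta> t \<omega>\<close> do not truncate.\<close>

locale generator_process = prob_space M for M :: "'a measure" +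
  fixes \<psi> :: "nat \<Rightarrow> real" and \<Delta> :: "nat \<Rightarrow> 'a \<Rightarrow> nat"
  assumes density: "waiting_time_density \<psi>"
    and indep: "indep_vars (\<lambda>_. count_space {1..}) \<Delta> {1..}"
    and distribution: "\<And>j t. 1 \<le> j \<Longrightarrow> 1 \<le> t \<Longrightarrow> prob {\<omega> \<in> space M. \<Delta> j \<omega> = t} = \<psi> t"

definition arrivals :: "(nat \<Rightarrow> 'a \<Rightarrow> nat) \<Rightarrow> nat \<Rightarrow> 'a \<Rightarrow> nat" where
  "arrivals \<Delta> t \<omega> = Max {n. (\<Sum>j=1..n. \<Delta> j \<omega>) \<le> t}"

definition arrival_prob :: "'a measure \<Rightarrow> (nat \<Rightarrow> 'a \<Rightarrow> nat) \<Rightarrow> nat \<Rightarrow> nat \<Rightarrow> real" where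
  "arrival_prob M \<Delta> t n = measure M {\<omega> \<in> space M. arrivals \<Delta> t \<omega> = n}"

definition state_polynomial ::
    "'a measure \<Rightarrow> (nat \<Rightarrow> 'a \<Rightarrow> nat) \<Rightarrow> 'k \<Rightarrow> 'k \<Rightarrow> nat
      \<Rightarrow> 'k::{real_normed_field, banach, second_countable_topology}" where
  "state_polynomial M \<Delta> a b t =
     (\<integral>\<omega>. a ^ arrivals \<Delta> t \<omega> * b ^ (t - arrivals \<Delta> t \<omega>) \<partial>M)"

text \<open>Matrices indexed by \<open>\<int> \<times> \<int>\<close>. The entries of products are unconditional sums, which
  converge for stochastic matrices.\<close>

type_synonym zmat = "int \<Rightarrow> int \<Rightarrow> real"

definition kronecker :: zmat where
  "kronecker p q = (if p = q then 1 else 0)"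

definition zmat_mult :: "zmat \<Rightarrow> zmat \<Rightarrow> zmat" (infixl "\<odot>" 70) where
  "(A \<odot> B) p q = (\<Sum>\<^sub>\<infinity>k. A p k * B k q)"

primrec zmat_power :: "zmat \<Rightarrow> nat \<Rightarrow> zmat" where
  "zmat_power A 0 = kronecker"
| "zmat_power A (Suc n) = A \<odot> zmat_power A n"

definition stochastic :: "zmat \<Rightarrow> bool" where
  "stochastic W \<longleftrightarrow> (\<forall>p q. 0 \<le> W p q) \<and> (\<forall>p. (W p has_sum 1) UNIV)"

definition toeplitz :: "zmat \<Rightarrow> bool" where
  "toeplitz W \<longleftrightarrow> (\<forall>p q s. W p q = W (p + s) (q + s))"

definition positive_jump_matrix :: "zmat \<Rightarrow> bool" where
  "positive_jump_matrix W \<longleftrightarrow> stochastic W \<and> toeplitz W \<and> (\<forall>p q. \<not> q > p \<longrightarrow> W p q = 0)"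

definition negative_jump_matrix :: "zmat \<Rightarrow> bool" where
  "negative_jump_matrix W \<longleftrightarrow> stochastic W \<and> toeplitz W \<and> (\<forall>p q. \<not> q < p \<longrightarrow> W p q = 0)"

definition adtrw_matrix :: "'a measure \<Rightarrow> (nat \<Rightarrow> 'a \<Rightarrow> nat) \<Rightarrow> zmat \<Rightarrow> zmat \<Rightarrow> nat \<Rightarrow> zmat" where
  "adtrw_matrix M \<Delta> Wp Wm t = (\<lambda>i j.
     \<Sum>n=0..t. arrival_prob M \<Delta> t n * (zmat_power Wp n \<odot> zmat_power Wm (t - n)) i j)"

definition unit_jump_up :: zmat where
  "unit_jump_up p q = kronecker p (q - 1)"

definition unit_jump_down :: zmat where
  "unit_jump_down p q = kronecker p (q + 1)"

definition simple_adtrw_matrix :: "'a measure \<Rightarrow> (nat \<Rightarrow> 'a \<Rightarrow> nat) \<Rightarrow> nat \<Rightarrow> zmat" where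
  "simple_adtrw_matrix M \<Delta> t = adtrw_matrix M \<Delta> unit_jump_up unit_jump_down t"

definition simple_walk :: "(nat \<Rightarrow> 'a \<Rightarrow> nat) \<Rightarrow> nat \<Rightarrow> 'a \<Rightarrow> int" where
  "simple_walk \<Delta> t \<omega> = 2 * int (arrivals \<Delta> t \<omega>) - int t"

end

theory Submission
  imports Defs
begin

text \<open>
  Everything rests on one recursion for the arrival law, \<open>p t n = P(N(t) = n)\<close>:
  \<open>p t (n + 1) = (\<Sum>r=1..t. \<psi> r * p (t - r) n)\<close> (\<open>arrival_prob_Suc\<close>). With \<open>S n\<close> the sum of the
  first \<open>n\<close> waiting times, \<open>N(t) \<ge> n\<close> means \<open>S n \<le> t\<close>, so \<open>p t n = P(S n \<le> t) - P(S (n + 1) \<le> t)\<close>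
  and it is enough to have the recursion for \<open>P(S n \<le> t)\<close>. Renewal equations are usually derived by
  conditioning on the first waiting time and restarting the process. Here the \<^emph>\<open>last\<close> waiting time
  is split off instead, \<open>S (n + 1) = S n + \<Delta> (n + 1)\<close>: this needs only the independence of \<open>S n\<close>
  and \<open>\<Delta> (n + 1)\<close> and never a shifted process.

  Summing the recursion against weights \<open>g n (t - n)\<close> in a real vector space gives one identity
  (\<open>renewal_sum\<close>) of which the three renewal equations are instances. The weights are
  \<open>a ^ n * b ^ m\<close> for the state polynomial, the entries of \<open>Wp\<^sup>n Wm\<^sup>m\<close> for the transition matrix,
  and the Kronecker symbol of \<open>i + n\<close> and \<open>j + m\<close> for the simple walk. In the matrix case the
  factor \<open>Wp Wm\<^sup>r\<^sup>-\<^sup>1\<close> has to be moved to the front, so infinite matrix products must be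
  associative (Tonelli, for stochastic matrices) and commutative (reflection of the summation index,
  for Toeplitz matrices).
\<close>

section \<open>The arrival law\<close>

context generator_process
begin

lemma waiting_time_measurable:
  assumes "1 \<le> j"
  shows "\<Delta> j \<in> M \<rightarrow>\<^sub>M count_space {1..}"
  using indep assms unfolding indep_vars_def by auto

lemma waiting_time_pos:
  assumes "1 \<le> j" "\<omega> \<in> space M"
  shows "1 \<le> \<Delta> j \<omega>"
  using measurable_space[OF waiting_time_measurable[OF assms(1)] assms(2)] by simp

lemma le_epoch:
  assumes "\<omega> \<in> space M"
  shows "n \<le> (\<Sum>j=1..n. \<Delta> j \<omega>)"
proof -
  have "(\<Sum>j=1..n. 1) \<le> (\<Sum>j=1..n. \<Delta> j \<omega>)"
    by (rule sum_mono) (use waiting_time_pos assms in auto)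
  then show ?thesis by simp
qed

lemma epoch_mono: "m \<le> n \<Longrightarrow> (\<Sum>j=1..m. \<Delta> j \<omega>) \<le> (\<Sum>j=1..n. \<Delta> j \<omega>)"
  by (rule sum_mono2) auto

lemma finite_arrival_counts:
  assumes "\<omega> \<in> space M"
  shows "finite {n. (\<Sum>j=1..n. \<Delta> j \<omega>) \<le> t}"
  by (rule finite_subset[of _ "{..t}"]) (use le_epoch[OF assms] order_trans in auto)

lemma le_arrivals_iff:
  assumes "\<omega> \<in> space M"
  shows "n \<le> arrivals \<Delta> t \<omega> \<longleftrightarrow> (\<Sum>j=1..n. \<Delta> j \<omega>) \<le> t"
proof -
  let ?A = "{n. (\<Sum>j=1..n. \<Delta> j \<omega>) \<le> t}"
  have ne: "?A \<noteq> {}"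
    by (auto intro!: exI[of _ 0])
  have "Max ?A \<in> ?A"
    by (rule Max_in[OF finite_arrival_counts[OF assms] ne])
  then have "n \<le> Max ?A \<Longrightarrow> (\<Sum>j=1..n. \<Delta> j \<omega>) \<le> t"
    using epoch_mono order_trans by blast
  moreover have "(\<Sum>j=1..n. \<Delta> j \<omega>) \<le> t \<Longrightarrow> n \<le> Max ?A"
    by (rule Max_ge[OF finite_arrival_counts[OF assms]]) simp
  ultimately show ?thesis
    unfolding arrivals_def by blast
qed

lemma arrivals_le:
  assumes "\<omega> \<in> space M"
  shows "arrivals \<Delta> t \<omega> \<le> t"
  using le_arrivals_iff[OF assms, of "arrivals \<Delta> t \<omega>" t] le_epoch[OF assms, of "arrivals \<Delta> t \<omega>"]
  by simp

lemma real_waiting_time_indep: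
  "indep_vars (\<lambda>_. borel) (\<lambda>j \<omega>. real (\<Delta> j \<omega>)) {1..}"
  by (rule indep_vars_compose2[OF indep]) auto

lemma real_waiting_time_measurable:
  assumes "1 \<le> j"
  shows "(\<lambda>\<omega>. real (\<Delta> j \<omega>)) \<in> borel_measurable M"
  using real_waiting_time_indep assms unfolding indep_vars_def by auto

lemma epoch_event: "{\<omega> \<in> space M. (\<Sum>j=1..n. \<Delta> j \<omega>) \<le> t} \<in> events"
proof -
  have [measurable]: "(\<lambda>\<omega>. \<Sum>j=1..n. real (\<Delta> j \<omega>)) \<in> borel_measurable M"
    by (rule borel_measurable_sum) (use real_waiting_time_measurable in auto)
  have "{\<omega> \<in> space M. (\<Sum>j=1..n. real (\<Delta> j \<omega>)) \<le> real t} \<in> events"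
    by measurable
  then show ?thesis
    by (simp flip: of_nat_sum)
qed

lemma waiting_time_event:
  assumes "1 \<le> j"
  shows "{\<omega> \<in> space M. \<Delta> j \<omega> = r} \<in> events"
proof -
  have [measurable]: "(\<lambda>\<omega>. real (\<Delta> j \<omega>)) \<in> borel_measurable M"
    by (rule real_waiting_time_measurable[OF assms])
  have "{\<omega> \<in> space M. real (\<Delta> j \<omega>) = real r} \<in> events"
    by measurable
  then show ?thesis by simp
qed

lemma prob_next_waiting_time_epoch:
  assumes "1 \<le> r"
  shows "prob {\<omega> \<in> space M. \<Delta> (Suc n) \<omega> = r \<and> (\<Sum>j=1..n. \<Delta> j \<omega>) \<le> s}
    = \<psi> r * prob {\<omega> \<in> space M. (\<Sum>j=1..n. \<Delta> j \<omega>) \<le> s}"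
proof -
  let ?X = "\<lambda>j \<omega>. real (\<Delta> j \<omega>)"
  have "indep_vars (\<lambda>_. borel) ?X (insert (Suc n) {1..n})"
    by (rule indep_vars_subset[OF real_waiting_time_indep]) auto
  then have "indep_var borel (?X (Suc n)) borel (\<lambda>\<omega>. \<Sum>j\<in>{1..n}. ?X j \<omega>)"
    by (intro indep_vars_sum) auto
  then have "prob ((\<lambda>\<omega>. (?X (Suc n) \<omega>, \<Sum>j=1..n. ?X j \<omega>)) -` ({real r} \<times> {..real s}) \<inter> space M)
      = prob (?X (Suc n) -` {real r} \<inter> space M)
        * prob ((\<lambda>\<omega>. \<Sum>j=1..n. ?X j \<omega>) -` {..real s} \<inter> space M)"
    by (rule indep_varD) auto
  moreover have "(\<lambda>\<omega>. (?X (Suc n) \<omega>, \<Sum>j=1..n. ?X j \<omega>)) -` ({real r} \<times> {..real s}) \<inter> space M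
      = {\<omega> \<in> space M. \<Delta> (Suc n) \<omega> = r \<and> (\<Sum>j=1..n. \<Delta> j \<omega>) \<le> s}"
    by (auto simp flip: of_nat_sum)
  moreover have "?X (Suc n) -` {real r} \<inter> space M = {\<omega> \<in> space M. \<Delta> (Suc n) \<omega> = r}"
    by auto
  moreover have "(\<lambda>\<omega>. \<Sum>j=1..n. ?X j \<omega>) -` {..real s} \<inter> space M
      = {\<omega> \<in> space M. (\<Sum>j=1..n. \<Delta> j \<omega>) \<le> s}"
    by (auto simp flip: of_nat_sum)
  ultimately show ?thesis
    using distribution[of "Suc n" r] assms by simp
qed

text \<open>The event is partitioned by the value \<open>r\<close> of the last waiting time; only \<open>1 \<le> r \<le> t\<close> can
  occur, since waiting times are positive.\<close>

lemma prob_epoch_Suc: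
  "prob {\<omega> \<in> space M. (\<Sum>j=1..Suc n. \<Delta> j \<omega>) \<le> t}
    = (\<Sum>r=1..t. \<psi> r * prob {\<omega> \<in> space M. (\<Sum>j=1..n. \<Delta> j \<omega>) \<le> t - r})"
proof -
  let ?B = "\<lambda>r. {\<omega> \<in> space M. \<Delta> (Suc n) \<omega> = r \<and> (\<Sum>j=1..n. \<Delta> j \<omega>) \<le> t - r}"
  have ev: "?B r \<in> events" for r
    using sets.Int[OF waiting_time_event[of "Suc n" r] epoch_event[of n "t - r"]]
    by (auto simp: Int_def conj_ac elim!: back_subst[of "\<lambda>A. A \<in> events"])
  have "{\<omega> \<in> space M. (\<Sum>j=1..Suc n. \<Delta> j \<omega>) \<le> t} = (\<Union>r\<in>{1..t}. ?B r)"
  proof (rule set_eqI)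
    fix \<omega>
    show "\<omega> \<in> {\<omega> \<in> space M. (\<Sum>j=1..Suc n. \<Delta> j \<omega>) \<le> t} \<longleftrightarrow> \<omega> \<in> (\<Union>r\<in>{1..t}. ?B r)"
      using waiting_time_pos[of "Suc n" \<omega>] by auto
  qed
  moreover have "prob (\<Union>r\<in>{1..t}. ?B r) = (\<Sum>r=1..t. prob (?B r))"
    by (rule finite_measure_finite_Union) (use ev in \<open>auto simp: disjoint_family_on_def\<close>)
  ultimately show ?thesis
    using prob_next_waiting_time_epoch by simp
qed

lemma arrivals_event_eq:
  "{\<omega> \<in> space M. arrivals \<Delta> t \<omega> = n}
    = {\<omega> \<in> space M. (\<Sum>j=1..n. \<Delta> j \<omega>) \<le> t} - {\<omega> \<in> space M. (\<Sum>j=1..Suc n. \<Delta> j \<omega>) \<le> t}"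
proof -
  have "k = n \<longleftrightarrow> n \<le> k \<and> \<not> Suc n \<le> k" for k :: nat
    by auto
  then show ?thesis
    using le_arrivals_iff by blast
qed

lemma arrivals_event: "{\<omega> \<in> space M. arrivals \<Delta> t \<omega> = n} \<in> events"
  unfolding arrivals_event_eq using epoch_event by blast

lemma arrival_prob_eq_diff:
  "arrival_prob M \<Delta> t n
    = prob {\<omega> \<in> space M. (\<Sum>j=1..n. \<Delta> j \<omega>) \<le> t}
      - prob {\<omega> \<in> space M. (\<Sum>j=1..Suc n. \<Delta> j \<omega>) \<le> t}"
  unfolding arrival_prob_def arrivals_event_eq
proof (rule finite_measure_Diff[OF epoch_event epoch_event])
  show "{\<omega> \<in> space M. (\<Sum>j=1..Suc n. \<Delta> j \<omega>) \<le> t} \<subseteq> {\<omega> \<in> space M. (\<Sum>j=1..n. \<Delta> j \<omega>) \<le> t}"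
    using epoch_mono[of n "Suc n"] order_trans by auto
qed

text \<open>The recursion for \<open>P(S n \<le> t)\<close> is linear with coefficients independent of \<open>n\<close>, hence
  passes to the differences that make up the arrival law.\<close>

lemma arrival_prob_Suc:
  "arrival_prob M \<Delta> t (Suc n) = (\<Sum>r=1..t. \<psi> r * arrival_prob M \<Delta> (t - r) n)"
  unfolding arrival_prob_eq_diff prob_epoch_Suc
  by (simp only: right_diff_distrib sum_subtractf)

lemma arrival_prob_0: "arrival_prob M \<Delta> 0 0 = 1"
proof -
  have "{\<omega> \<in> space M. arrivals \<Delta> 0 \<omega> = 0} = space M"
    using arrivals_le[of _ 0] by auto
  then show ?thesis
    by (simp add: arrival_prob_def prob_space)
qed

text \<open>The second argument of \<open>g\<close> on the right is \<open>t - Suc m\<close>, split into the \<open>r - 1\<close> steps without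
  arrival before the first arrival at time \<open>r\<close> and the remaining \<open>t - r - m\<close> such steps. For
  multiplicative \<open>g\<close> the inner sum then factors into the contribution of the steps up to \<open>r\<close> and
  the left-hand side at time \<open>t - r\<close>.\<close>

lemma renewal_sum:
  fixes g :: "nat \<Rightarrow> nat \<Rightarrow> 'v::real_vector"
  shows "(\<Sum>n=0..t. arrival_prob M \<Delta> t n *\<^sub>R g n (t - n))
    = arrival_prob M \<Delta> t 0 *\<^sub>R g 0 t
      + (\<Sum>r=1..t. \<psi> r *\<^sub>R
          (\<Sum>m=0..t - r. arrival_prob M \<Delta> (t - r) m *\<^sub>R g (Suc m) (r - 1 + (t - r - m))))"
proof -
  let ?p = "arrival_prob M \<Delta>"
  have "(\<Sum>n=0..t. ?p t n *\<^sub>R g n (t - n))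
      = ?p t 0 *\<^sub>R g 0 t + (\<Sum>m<t. ?p t (Suc m) *\<^sub>R g (Suc m) (t - Suc m))"
    by (simp only: atLeast0AtMost sum.atMost_shift) simp
  also have "(\<Sum>m<t. ?p t (Suc m) *\<^sub>R g (Suc m) (t - Suc m))
      = (\<Sum>m<t. \<Sum>r=1..t. \<psi> r *\<^sub>R ?p (t - r) m *\<^sub>R g (Suc m) (t - Suc m))"
    by (simp add: arrival_prob_Suc scaleR_sum_left)
  also have "\<dots> = (\<Sum>r=1..t. \<Sum>m<t. \<psi> r *\<^sub>R ?p (t - r) m *\<^sub>R g (Suc m) (t - Suc m))"
    by (rule sum.swap)
  also have "\<dots> = (\<Sum>r=1..t. \<psi> r *\<^sub>R
      (\<Sum>m=0..t - r. ?p (t - r) m *\<^sub>R g (Suc m) (r - 1 + (t - r - m))))"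
  proof (rule sum.cong[OF refl])
    fix r assume r: "r \<in> {1..t}"
    \<comment> \<open>More than \<open>t - r\<close> arrivals up to time \<open>t - r\<close> are impossible, so the range of \<open>m\<close> shrinks.\<close>
    have "(\<Sum>m<t. ?p (t - r) m *\<^sub>R g (Suc m) (t - Suc m))
        = (\<Sum>m=0..t - r. ?p (t - r) m *\<^sub>R g (Suc m) (t - Suc m))"
    proof (rule sum.mono_neutral_right)
      show "\<forall>m\<in>{..<t} - {0..t - r}. ?p (t - r) m *\<^sub>R g (Suc m) (t - Suc m) = 0"
      proof
        fix m assume "m \<in> {..<t} - {0..t - r}"
        then have "{\<omega> \<in> space M. arrivals \<Delta> (t - r) \<omega> = m} = {}"
          using arrivals_le[of _ "t - r"] by fastforce
        then show "?p (t - r) m *\<^sub>R g (Suc m) (t - Suc m) = 0"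
          by (simp add: arrival_prob_def del: Collect_empty_eq)
      qed
    qed (use r in auto)
    also have "\<dots> = (\<Sum>m=0..t - r. ?p (t - r) m *\<^sub>R g (Suc m) (r - 1 + (t - r - m)))"
    proof (rule sum.cong[OF refl])
      fix m assume "m \<in> {0..t - r}"
      then have "t - Suc m = r - 1 + (t - r - m)"
        using r by auto
      then show "?p (t - r) m *\<^sub>R g (Suc m) (t - Suc m)
          = ?p (t - r) m *\<^sub>R g (Suc m) (r - 1 + (t - r - m))"
        by simp
    qed
    finally show "(\<Sum>m<t. \<psi> r *\<^sub>R ?p (t - r) m *\<^sub>R g (Suc m) (t - Suc m))
        = \<psi> r *\<^sub>R (\<Sum>m=0..t - r. ?p (t - r) m *\<^sub>R g (Suc m) (r - 1 + (t - r - m)))"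
      by (simp only: flip: scaleR_sum_right)
  qed
  finally show ?thesis .
qed

text \<open>The count at time \<open>t\<close> takes only the values \<open>0, \<dots>, t\<close>, so the expectation is a finite sum.
  It serves both the state polynomial and, with an indicator for \<open>f\<close>, the law of the simple walk.\<close>

lemma integral_arrivals:
  fixes f :: "nat \<Rightarrow> 'v::{banach, second_countable_topology}"
  shows "(\<integral>\<omega>. f (arrivals \<Delta> t \<omega>) \<partial>M) = (\<Sum>n=0..t. arrival_prob M \<Delta> t n *\<^sub>R f n)"
proof -
  let ?E = "\<lambda>n. {\<omega> \<in> space M. arrivals \<Delta> t \<omega> = n}"
  have int: "integrable M (\<lambda>\<omega>. indicator (?E n) \<omega> *\<^sub>R f n)" for n
    by (rule integrable_scaleR_left) (simp add: arrivals_event emeasure_eq_measure)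
  have "(\<integral>\<omega>. f (arrivals \<Delta> t \<omega>) \<partial>M) = (\<integral>\<omega>. (\<Sum>n=0..t. indicator (?E n) \<omega> *\<^sub>R f n) \<partial>M)"
  proof (rule Bochner_Integration.integral_cong[OF refl])
    fix \<omega> assume \<omega>: "\<omega> \<in> space M"
    have "(\<Sum>n=0..t. indicator (?E n) \<omega> *\<^sub>R f n)
        = (\<Sum>n=0..t. if n = arrivals \<Delta> t \<omega> then f n else 0)"
      by (rule sum.cong) (use \<omega> in \<open>auto simp: indicator_def\<close>)
    then show "f (arrivals \<Delta> t \<omega>) = (\<Sum>n=0..t. indicator (?E n) \<omega> *\<^sub>R f n)"
      using arrivals_le[OF \<omega>, of t] by simp
  qed
  also have "\<dots> = (\<Sum>n=0..t. arrival_prob M \<Delta> t n *\<^sub>R f n)"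
    unfolding Bochner_Integration.integral_sum[OF int]
  proof (rule sum.cong[OF refl])
    fix n
    have "(\<integral>\<omega>. indicator (?E n) \<omega> *\<^sub>R f n \<partial>M) = measure M (?E n \<inter> space M) *\<^sub>R f n"
      using arrivals_event by (subst integral_scaleR_left) (simp_all add: emeasure_eq_measure)
    then show "(\<integral>\<omega>. indicator (?E n) \<omega> *\<^sub>R f n \<partial>M) = arrival_prob M \<Delta> t n *\<^sub>R f n"
      by (simp add: arrival_prob_def Int_def conj_ac)
  qed
  finally show ?thesis .
qed

lemma state_polynomial_eq_sum:
  "state_polynomial M \<Delta> a b t
    = (\<Sum>n=0..t. arrival_prob M \<Delta> t n *\<^sub>R (a ^ n * b ^ (t - n)))"
  unfolding state_polynomial_def by (rule integral_arrivals)

lemma state_polynomial_renewal: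
  "state_polynomial M \<Delta> a b t
    = b ^ t * of_real (arrival_prob M \<Delta> t 0)
      + (\<Sum>r=1..t. a * b ^ (r - 1) * of_real (\<psi> r) * state_polynomial M \<Delta> a b (t - r))"
proof -
  have "\<psi> r *\<^sub>R (\<Sum>m=0..t - r. arrival_prob M \<Delta> (t - r) m *\<^sub>R (a ^ Suc m * b ^ (r - 1 + (t - r - m))))
      = a * b ^ (r - 1) * of_real (\<psi> r) * state_polynomial M \<Delta> a b (t - r)" for r
    unfolding state_polynomial_eq_sum
    by (simp add: scaleR_conv_of_real sum_distrib_left power_add algebra_simps)
  then show ?thesis
    unfolding state_polynomial_eq_sum[of a b t] renewal_sum[where g = "\<lambda>n m. a ^ n * b ^ m"]
    by (simp only:) (simp add: scaleR_conv_of_real)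
qed

end

section \<open>Stochastic and Toeplitz matrices over the integers\<close>

lemma stochastic_le_1:
  assumes "stochastic A"
  shows "A p q \<le> 1"
proof -
  have "(A p has_sum A p q) {q}"
    using has_sum_finite[of "{q}" "A p"] by simp
  moreover have "(A p has_sum 1) UNIV"
    using assms by (simp add: stochastic_def)
  ultimately show ?thesis
    by (rule has_sum_mono2) (use assms in \<open>auto simp: stochastic_def\<close>)
qed

lemma stochastic_mult_summable:
  assumes "stochastic A" "stochastic B"
  shows "(\<lambda>k. A p k * B k q) summable_on UNIV"
proof (rule summable_on_comparison_test)
  show "A p summable_on UNIV"
    using assms(1) by (auto simp: stochastic_def summable_on_def)
  show "A p k * B k q \<le> A p k" for k
    using assms stochastic_le_1[OF assms(2), of k q]
    by (simp add: stochastic_def mult_left_le)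
  show "0 \<le> A p k * B k q" for k
    using assms by (simp add: stochastic_def)
qed

lemma stochastic_mult_has_sum:
  assumes "stochastic A" "stochastic B"
  shows "((\<lambda>k. A p k * B k q) has_sum (A \<odot> B) p q) UNIV"
  unfolding zmat_mult_def by (rule has_sum_infsum[OF stochastic_mult_summable[OF assms]])

text \<open>Row \<open>p\<close> of the product sums to 1 because the nonnegative double family
  \<open>A p k * B k l\<close> does: summing over \<open>l\<close> first leaves row \<open>p\<close> of \<open>A\<close>.\<close>

lemma stochastic_mult:
  assumes A: "stochastic A" and B: "stochastic B"
  shows "stochastic (A \<odot> B)"
  unfolding stochastic_def
proof (intro conjI allI)
  fix p q
  have row: "((\<lambda>l. A p k * B k l) has_sum A p k) UNIV" for k
    using has_sum_cmult_right[of "B k" UNIV 1 "A p k"] B by (simp add: stochastic_def)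
  have A1: "(A p has_sum 1) UNIV"
    using A by (simp add: stochastic_def)
  show "0 \<le> (A \<odot> B) p q"
    unfolding zmat_mult_def by (rule infsum_nonneg) (use A B in \<open>simp add: stochastic_def\<close>)
  have "(\<lambda>(k, l). A p k * B k l) summable_on UNIV \<times> UNIV"
    by (rule summable_on_SigmaI[where g = "A p"])
      (use row A1 A B in \<open>auto simp: stochastic_def summable_on_def\<close>)
  then have "((\<lambda>(k, l). A p k * B k l) has_sum 1) (UNIV \<times> UNIV)"
    by (intro has_sum_SigmaI[where g = "A p"]) (use row A1 in auto)
  then have "((\<lambda>(l, k). A p k * B k l) has_sum 1) (UNIV \<times> UNIV)"
    by (subst (asm) has_sum_swap) (simp add: case_prod_unfold)
  then show "((A \<odot> B) p has_sum 1) UNIV"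
    by (rule has_sum_SigmaD) (use stochastic_mult_has_sum[OF A B] in simp)
qed

text \<open>Tonelli: the terms \<open>A p k * B k l * C l q\<close> are nonnegative and their iterated sum is an entry
  of a product of stochastic matrices, so they are summable as a double family.\<close>

lemma stochastic_mult_assoc:
  assumes A: "stochastic A" and B: "stochastic B" and C: "stochastic C"
  shows "A \<odot> B \<odot> C = A \<odot> (B \<odot> C)"
proof (intro ext)
  fix p q
  have inner: "((\<lambda>l. A p k * (B k l * C l q)) has_sum A p k * (B \<odot> C) k q) UNIV" for k
    by (rule has_sum_cmult_right[OF stochastic_mult_has_sum[OF B C]])
  have "(\<lambda>(k, l). A p k * (B k l * C l q)) summable_on UNIV \<times> UNIV"
    by (rule summable_on_SigmaI[where g = "\<lambda>k. A p k * (B \<odot> C) k q"])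
      (use inner stochastic_mult_summable[OF A stochastic_mult[OF B C]] A B C
        in \<open>auto simp: stochastic_def\<close>)
  then have "(\<Sum>\<^sub>\<infinity>k. \<Sum>\<^sub>\<infinity>l. A p k * (B k l * C l q)) = (\<Sum>\<^sub>\<infinity>l. \<Sum>\<^sub>\<infinity>k. A p k * (B k l * C l q))"
    by (rule infsum_swap_banach)
  then show "(A \<odot> B \<odot> C) p q = (A \<odot> (B \<odot> C)) p q"
    unfolding zmat_mult_def infsum_cmult_left'[symmetric] infsum_cmult_right'[symmetric]
    by (simp add: mult.assoc)
qed

text \<open>The reflection \<open>k \<mapsto> p + q - k\<close> exchanges the two displacements \<open>k - p\<close> and \<open>q - k\<close>, on which
  alone the factors depend. It carries the terms of one sum to those of the other, so the
  equality holds whether or not they converge.\<close>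

lemma toeplitz_mult_commute:
  assumes "toeplitz A" "toeplitz B"
  shows "A \<odot> B = B \<odot> A"
proof (intro ext)
  fix p q :: int
  have bij: "bij_betw (\<lambda>k. p + q - k) UNIV UNIV"
    by (rule bij_betw_byWitness[of _ "\<lambda>k. p + q - k"]) auto
  have "A p (p + q - k) = A k q" "B (p + q - k) q = B p k" for k
    using assms(1)[unfolded toeplitz_def, rule_format, of p "p + q - k" "k - p"]
      assms(2)[unfolded toeplitz_def, rule_format, of "p + q - k" q "k - q"]
    by (simp_all add: algebra_simps)
  then have "(\<Sum>\<^sub>\<infinity>k. A p k * B k q) = (\<Sum>\<^sub>\<infinity>k. B p k * A k q)"
    using infsum_reindex_bij_betw[OF bij, of "\<lambda>k. A p k * B k q"] by (simp add: mult.commute)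
  then show "(A \<odot> B) p q = (B \<odot> A) p q"
    by (simp add: zmat_mult_def)
qed

lemma toeplitz_mult:
  assumes "toeplitz A" "toeplitz B"
  shows "toeplitz (A \<odot> B)"
  unfolding toeplitz_def
proof (intro allI)
  fix p q s :: int
  have bij: "bij_betw (\<lambda>k. k + s) UNIV UNIV"
    by (rule bij_betw_byWitness[of _ "\<lambda>k. k - s"]) auto
  show "(A \<odot> B) p q = (A \<odot> B) (p + s) (q + s)"
    unfolding zmat_mult_def
      infsum_reindex_bij_betw[OF bij, of "\<lambda>k. A (p + s) k * B k (q + s)", symmetric]
    using assms by (simp add: toeplitz_def)
qed

lemma kronecker_mult_left: "(kronecker \<odot> A) p q = A p q"
proof -
  have "(\<Sum>\<^sub>\<infinity>k. kronecker p k * A k q) = (\<Sum>\<^sub>\<infinity>k\<in>{p}. kronecker p k * A k q)"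
    by (rule infsum_cong_neutral) (auto simp: kronecker_def)
  then show ?thesis
    by (simp add: zmat_mult_def kronecker_def)
qed

lemma stochastic_kronecker: "stochastic kronecker"
  unfolding stochastic_def
proof (intro conjI allI)
  show "(kronecker p has_sum 1) UNIV" for p
    by (rule has_sum_finite_neutralI[of "{p}"]) (auto simp: kronecker_def)
qed (simp add: kronecker_def)

lemma toeplitz_kronecker: "toeplitz kronecker"
  by (simp add: toeplitz_def kronecker_def)

lemma stochastic_power: "stochastic A \<Longrightarrow> stochastic (zmat_power A n)"
  by (induction n) (auto intro: stochastic_kronecker stochastic_mult)

lemma toeplitz_power: "toeplitz A \<Longrightarrow> toeplitz (zmat_power A n)"
  by (induction n) (auto intro: toeplitz_kronecker toeplitz_mult)

lemma zmat_power_add: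
  assumes "stochastic A"
  shows "zmat_power A (m + n) = zmat_power A m \<odot> zmat_power A n"
proof (induction m)
  case 0
  show ?case
    by (intro ext) (simp add: kronecker_mult_left)
next
  case (Suc m)
  then show ?case
    using stochastic_mult_assoc[OF assms stochastic_power[OF assms] stochastic_power[OF assms]]
    by simp
qed

lemma jump_matrix_mult_power:
  assumes P: "stochastic P" "toeplitz P" and Q: "stochastic Q" "toeplitz Q"
  shows "zmat_power P (Suc m) \<odot> zmat_power Q (r + k)
    = P \<odot> zmat_power Q r \<odot> (zmat_power P m \<odot> zmat_power Q k)"
proof -
  let ?Pm = "zmat_power P m" and ?Qr = "zmat_power Q r" and ?Qk = "zmat_power Q k"
  note st = P(1) stochastic_power[OF P(1)] stochastic_power[OF Q(1)] stochastic_mult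
  have "zmat_power P (Suc m) \<odot> zmat_power Q (r + k) = P \<odot> (?Pm \<odot> (?Qr \<odot> ?Qk))"
    by (simp add: zmat_power_add[OF Q(1)] stochastic_mult_assoc st)
  also have "?Pm \<odot> (?Qr \<odot> ?Qk) = ?Pm \<odot> ?Qr \<odot> ?Qk"
    by (simp add: stochastic_mult_assoc st)
  also have "?Pm \<odot> ?Qr = ?Qr \<odot> ?Pm"
    by (rule toeplitz_mult_commute) (simp_all add: toeplitz_power P Q)
  also have "P \<odot> (?Qr \<odot> ?Pm \<odot> ?Qk) = P \<odot> ?Qr \<odot> (?Pm \<odot> ?Qk)"
    by (simp add: stochastic_mult_assoc st)
  finally show ?thesis .
qed

lemma stochastic_mult_sum_right:
  assumes "stochastic A" "\<And>n. n \<in> I \<Longrightarrow> stochastic (B n)"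
  shows "(A \<odot> (\<lambda>i j. \<Sum>n\<in>I. c n * B n i j)) i j = (\<Sum>n\<in>I. c n * (A \<odot> B n) i j)"
proof -
  have "((\<lambda>k. \<Sum>n\<in>I. c n * (A i k * B n k j)) has_sum (\<Sum>n\<in>I. c n * (A \<odot> B n) i j)) UNIV"
    using assms(2)
  proof (induction I rule: infinite_finite_induct)
    case (insert n I)
    then show ?case
      by (auto intro!: has_sum_add has_sum_cmult_right stochastic_mult_has_sum assms(1))
  qed simp_all
  then have "(\<Sum>\<^sub>\<infinity>k. \<Sum>n\<in>I. c n * (A i k * B n k j)) = (\<Sum>n\<in>I. c n * (A \<odot> B n) i j)"
    by (rule infsumI)
  then show ?thesis
    by (simp add: zmat_mult_def sum_distrib_left mult.left_commute)
qed

section \<open>Transition matrices\<close>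

context generator_process
begin

lemma adtrw_matrix_0: "adtrw_matrix M \<Delta> Wp Wm 0 = kronecker"
  by (intro ext) (simp add: adtrw_matrix_def arrival_prob_0 kronecker_mult_left)

lemma adtrw_matrix_renewal:
  assumes P: "stochastic Wp" "toeplitz Wp" and Q: "stochastic Wm" "toeplitz Wm"
  shows "adtrw_matrix M \<Delta> Wp Wm t i j
    = zmat_power Wm t i j * arrival_prob M \<Delta> t 0
      + (\<Sum>r=1..t. \<psi> r *
          (Wp \<odot> zmat_power Wm (r - 1) \<odot> adtrw_matrix M \<Delta> Wp Wm (t - r)) i j)"
proof -
  let ?g = "\<lambda>n m. (zmat_power Wp n \<odot> zmat_power Wm m) i j"
  have inner: "(\<Sum>m=0..t - r. arrival_prob M \<Delta> (t - r) m *\<^sub>R ?g (Suc m) (r - 1 + (t - r - m)))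
      = (Wp \<odot> zmat_power Wm (r - 1) \<odot> adtrw_matrix M \<Delta> Wp Wm (t - r)) i j" for r
    unfolding adtrw_matrix_def jump_matrix_mult_power[OF P Q]
    by (subst stochastic_mult_sum_right) (simp_all add: stochastic_mult stochastic_power P Q)
  have "adtrw_matrix M \<Delta> Wp Wm t i j = (\<Sum>n=0..t. arrival_prob M \<Delta> t n *\<^sub>R ?g n (t - n))"
    by (simp add: adtrw_matrix_def)
  also have "\<dots> = zmat_power Wm t i j * arrival_prob M \<Delta> t 0
      + (\<Sum>r=1..t. \<psi> r *
          (Wp \<odot> zmat_power Wm (r - 1) \<odot> adtrw_matrix M \<Delta> Wp Wm (t - r)) i j)"
    unfolding renewal_sum[where g = ?g] inner by (simp add: kronecker_mult_left)
  finally show ?thesis .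
qed

end

lemma unit_jump_up_power: "zmat_power unit_jump_up n p q = kronecker (p + int n) q"
proof (induction n arbitrary: p)
  case (Suc n)
  have "unit_jump_up \<odot> A = (\<lambda>p. A (p + 1))" for A
  proof (intro ext)
    fix p q
    have "(\<Sum>\<^sub>\<infinity>k. unit_jump_up p k * A k q) = (\<Sum>\<^sub>\<infinity>k\<in>{p + 1}. unit_jump_up p k * A k q)"
      by (rule infsum_cong_neutral) (auto simp: unit_jump_up_def kronecker_def)
    then show "(unit_jump_up \<odot> A) p q = A (p + 1) q"
      by (simp add: zmat_mult_def unit_jump_up_def kronecker_def)
  qed
  then show ?case
    by (simp add: Suc algebra_simps)
qed simp

lemma unit_jump_down_power: "zmat_power unit_jump_down n p q = kronecker p (q + int n)"
proof (induction n arbitrary: p)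
  case (Suc n)
  have "unit_jump_down \<odot> A = (\<lambda>p. A (p - 1))" for A
  proof (intro ext)
    fix p q
    have "(\<Sum>\<^sub>\<infinity>k. unit_jump_down p k * A k q) = (\<Sum>\<^sub>\<infinity>k\<in>{p - 1}. unit_jump_down p k * A k q)"
      by (rule infsum_cong_neutral) (auto simp: unit_jump_down_def kronecker_def)
    then show "(unit_jump_down \<odot> A) p q = A (p - 1) q"
      by (simp add: zmat_mult_def unit_jump_down_def kronecker_def)
  qed
  then show ?case
    by (auto simp: Suc kronecker_def)
qed simp

lemma unit_jump_powers:
  "(zmat_power unit_jump_up n \<odot> zmat_power unit_jump_down m) i j = kronecker (i + int n) (j + int m)"
proof -
  have "zmat_power unit_jump_up n \<odot> A = (\<lambda>p. A (p + int n))" for A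
  proof (intro ext)
    fix p q
    have "(zmat_power unit_jump_up n \<odot> A) p q = (kronecker \<odot> A) (p + int n) q"
      by (simp add: zmat_mult_def unit_jump_up_power)
    then show "(zmat_power unit_jump_up n \<odot> A) p q = A (p + int n) q"
      by (simp add: kronecker_mult_left)
  qed
  then show ?thesis
    by (simp add: unit_jump_down_power)
qed

context generator_process
begin

lemma simple_adtrw_matrix_eq_sum:
  "simple_adtrw_matrix M \<Delta> t i j
    = (\<Sum>n=0..t. arrival_prob M \<Delta> t n * kronecker (i + int n) (j + int (t - n)))"
  by (simp add: simple_adtrw_matrix_def adtrw_matrix_def unit_jump_powers)

lemma simple_adtrw_matrix_law:
  "simple_adtrw_matrix M \<Delta> t i j = prob {\<omega> \<in> space M. simple_walk \<Delta> t \<omega> = j - i}"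
proof -
  let ?f = "\<lambda>n. if 2 * int n - int t = j - i then 1 else 0 :: real"
  have ev: "{\<omega> \<in> space M. simple_walk \<Delta> t \<omega> = j - i} \<in> events"
  proof -
    have "{\<omega> \<in> space M. simple_walk \<Delta> t \<omega> = j - i}
        = (\<Union>n\<in>{n. 2 * int n - int t = j - i}. {\<omega> \<in> space M. arrivals \<Delta> t \<omega> = n})"
      by (auto simp: simple_walk_def)
    then show ?thesis
      using arrivals_event by auto
  qed
  have "simple_adtrw_matrix M \<Delta> t i j = (\<Sum>n=0..t. arrival_prob M \<Delta> t n *\<^sub>R ?f n)"
    unfolding simple_adtrw_matrix_eq_sum
    by (rule sum.cong) (auto simp: kronecker_def of_nat_diff)
  also have "\<dots> = (\<integral>\<omega>. ?f (arrivals \<Delta> t \<omega>) \<partial>M)"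
    by (rule integral_arrivals[symmetric])
  also have "\<dots> = (\<integral>\<omega>. indicator {\<omega> \<in> space M. simple_walk \<Delta> t \<omega> = j - i} \<omega> \<partial>M)"
    by (rule Bochner_Integration.integral_cong) (auto simp: simple_walk_def)
  also have "\<dots> = prob {\<omega> \<in> space M. simple_walk \<Delta> t \<omega> = j - i}"
    using ev by simp
  finally show ?thesis .
qed

text \<open>With a first arrival at \<open>r\<close>, the walk has moved by \<open>1 - (r - 1) = 2 - r\<close>; by translation
  invariance the displacement is charged to the target state.\<close>

lemma simple_adtrw_matrix_renewal:
  "simple_adtrw_matrix M \<Delta> t i j
    = arrival_prob M \<Delta> t 0 * kronecker i (j + int t)
      + (\<Sum>r=1..t. \<psi> r * simple_adtrw_matrix M \<Delta> (t - r) i (j + int r - 2))"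
proof -
  have "kronecker (i + int (Suc m)) (j + int (r - 1 + k)) = kronecker (i + int m) (j + int r - 2 + int k)"
    if "1 \<le> r" for m r k
    using that by (auto simp: kronecker_def)
  then show ?thesis
    using renewal_sum[where g = "\<lambda>n m. kronecker (i + int n) (j + int m)" and t = t]
    by (simp add: simple_adtrw_matrix_eq_sum del: of_nat_Suc of_nat_add)
qed

end

theorem mainTheorem6:
  fixes M :: "'a measure" and \<psi> :: "nat \<Rightarrow> real" and \<Delta> :: "nat \<Rightarrow> 'a \<Rightarrow> nat"
  assumes "generator_process M \<psi> \<Delta>"
  shows
    "(\<forall>(a :: 'k::{real_normed_field, banach, second_countable_topology}) b.
        (\<forall>t. state_polynomial M \<Delta> a b t
           = (\<Sum>n=0..t. of_real (arrival_prob M \<Delta> t n) * a ^ n * b ^ (t - n))) \<and>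
        state_polynomial M \<Delta> a b 0 = 1 \<and>
        (\<forall>t\<ge>1. state_polynomial M \<Delta> a b t
           = b ^ t * of_real (arrival_prob M \<Delta> t 0)
             + (\<Sum>r=1..t. a * b ^ (r - 1) * of_real (\<psi> r) * state_polynomial M \<Delta> a b (t - r))))
     \<and>
     (\<forall>Wp Wm. positive_jump_matrix Wp \<longrightarrow> negative_jump_matrix Wm \<longrightarrow>
        adtrw_matrix M \<Delta> Wp Wm 0 = kronecker \<and>
        (\<forall>t\<ge>1. adtrw_matrix M \<Delta> Wp Wm t = (\<lambda>i j.
           zmat_power Wm t i j * arrival_prob M \<Delta> t 0
           + (\<Sum>r=1..t. \<psi> r *
                (Wp \<odot> zmat_power Wm (r - 1) \<odot> adtrw_matrix M \<Delta> Wp Wm (t - r)) i j))))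
     \<and>
     (\<forall>i j.
        (\<forall>t. simple_adtrw_matrix M \<Delta> t i j
           = measure M {\<omega> \<in> space M. simple_walk \<Delta> t \<omega> = j - i}) \<and>
        simple_adtrw_matrix M \<Delta> 0 i j = kronecker i j \<and>
        (\<forall>t\<ge>1. simple_adtrw_matrix M \<Delta> t i j
           = arrival_prob M \<Delta> t 0 * kronecker i (j + int t)
             + (\<Sum>r=1..t. \<psi> r * simple_adtrw_matrix M \<Delta> (t - r) i (j + int r - 2))))"
proof -
  interpret generator_process M \<psi> \<Delta> by (rule assms)
  have polynomial_sum: "state_polynomial M \<Delta> a b t
      = (\<Sum>n=0..t. of_real (arrival_prob M \<Delta> t n) * a ^ n * b ^ (t - n))" for a b :: 'k and t
    by (simp add: state_polynomial_eq_sum scaleR_conv_of_real mult.assoc)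
  have polynomial_0: "state_polynomial M \<Delta> a b 0 = 1" for a b :: 'k
    by (simp add: polynomial_sum arrival_prob_0)
  have simple_0: "simple_adtrw_matrix M \<Delta> 0 = kronecker"
    by (simp add: simple_adtrw_matrix_def adtrw_matrix_0)
  show ?thesis
    by (intro conjI allI impI ext polynomial_sum polynomial_0 state_polynomial_renewal
        adtrw_matrix_0 adtrw_matrix_renewal simple_adtrw_matrix_law simple_adtrw_matrix_renewal)
      (auto simp: simple_0 positive_jump_matrix_def negative_jump_matrix_def)
qed

end
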